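(* For every Hausdorff space $X$, $|X| \leq 2^{pwL_c(X) \cdot \chi(X)}$.
   Context: For a topological space $X$, a decomposition $\{\mathcal{U}_i : i \in I\}$ of a family $\mathcal{U}$ of sets is an indexed collection (with arbitrary index set $I$) of subfamilies of $\mathcal{U}$ with $\mathcal{U} = \bigcup_{i \in I} \mathcal{U}_i$; the subfamilies need not be pairwise disjoint. The piecewise weak Lindelöf degree for closed sets, $pwL_c(X)$, is the least cardinal $\kappa$ such that for every closed set $F \subseteq X$, every family $\mathcal{U}$ of open subsets of $X$ with $F \subseteq \bigcup \mathcal{U}$, and every decomposition $\{\mathcal{U}_i : i \in I\}$ of $\mathcal{U}$, there are subfamilies $\mathcal{V}_i \subseteq \mathcal{U}_i$ with $|\mathcal{V}_i| \leq \kappa$ for every $i \in I$, such that $F \subseteq \bigcup \{\overline{\bigcup \mathcal{V}_i} : i \in I\}$. $\chi(X)$ is the character of $X$: the least cardinal $\kappa$ such that every point of $X$ has a local base of size at most $\kappa$. Convention: all cardinal functions are taken to be infinite, i.e. each is the least infinite cardinal with the stated property. *)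

theory Defs
  imports "HOL-Analysis.Analysis"
begin

unbundle cardinal_syntax

text \<open>
  Cardinals are the \<open>Card_order\<close> relations of the library, compared by \<open>\<le>o\<close>.
  A cardinal function of a space over \<open>'a\<close> is given as a cardinal on \<open>'a set + nat\<close>;
  this type is infinite and at least as large as the set of all open sets, so both
  cardinal functions below are attained in it. The lemmas \<open>pwLc_least\<close> and
  \<open>character_least\<close> show that the values are least among the infinite cardinals on
  all types.
\<close>

definition least_Cinfinite :: "('k rel \<Rightarrow> bool) \<Rightarrow> 'k rel" where
  "least_Cinfinite P =
     (SOME \<kappa>. Cinfinite \<kappa> \<and> P \<kappa> \<and> (\<forall>\<mu>. Cinfinite \<mu> \<and> P \<mu> \<longrightarrow> \<kappa> \<le>o \<mu>))"

text \<open>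
  Indices are taken from \<open>'a set set\<close>, which is large enough to index all families of
  subfamilies; lemma \<open>pwLc_bound_any_index\<close> extends the property to index sets of
  arbitrary type.
\<close>

definition pwLc_bound :: "'a topology \<Rightarrow> 'k rel \<Rightarrow> bool" where
  "pwLc_bound X \<kappa> \<longleftrightarrow>
     (\<forall>F \<U> (I :: 'a set set set) (\<D> :: 'a set set \<Rightarrow> 'a set set).
        closedin X F \<and> (\<forall>U\<in>\<U>. openin X U) \<and> F \<subseteq> \<Union>\<U> \<and> \<U> = (\<Union>i\<in>I. \<D> i) \<longrightarrow>
        (\<exists>\<V>. (\<forall>i\<in>I. \<V> i \<subseteq> \<D> i \<and> |\<V> i| \<le>o \<kappa>) \<and>
             F \<subseteq> (\<Union>i\<in>I. X closure_of (\<Union>(\<V> i)))))"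

definition pwLc :: "'a topology \<Rightarrow> ('a set + nat) rel" where
  "pwLc X = least_Cinfinite (pwLc_bound X)"

definition local_base_at :: "'a topology \<Rightarrow> 'a \<Rightarrow> 'a set set \<Rightarrow> bool" where
  "local_base_at X x \<B> \<longleftrightarrow>
     (\<forall>B\<in>\<B>. openin X B \<and> x \<in> B) \<and>
     (\<forall>U. openin X U \<and> x \<in> U \<longrightarrow> (\<exists>B\<in>\<B>. B \<subseteq> U))"

definition character_bound :: "'a topology \<Rightarrow> 'k rel \<Rightarrow> bool" where
  "character_bound X \<kappa> \<longleftrightarrow> (\<forall>x\<in>topspace X. \<exists>\<B>. local_base_at X x \<B> \<and> |\<B>| \<le>o \<kappa>)"

definition character :: "'a topology \<Rightarrow> ('a set + nat) rel" where
  "character X = least_Cinfinite (character_bound X)"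


lemma pwLc_bound_any_index:
  fixes I :: "'i set" and \<D> :: "'i \<Rightarrow> 'a set set"
  assumes "pwLc_bound X \<kappa>" "closedin X F" "\<forall>U\<in>\<U>. openin X U" "F \<subseteq> \<Union>\<U>"
    and "\<U> = (\<Union>i\<in>I. \<D> i)"
  shows "\<exists>\<V>. (\<forall>i\<in>I. \<V> i \<subseteq> \<D> i \<and> |\<V> i| \<le>o \<kappa>) \<and> F \<subseteq> (\<Union>i\<in>I. X closure_of (\<Union>(\<V> i)))"
proof -
  have "closedin X F \<and> (\<forall>U\<in>\<U>. openin X U) \<and> F \<subseteq> \<Union>\<U> \<and> \<U> = (\<Union>d\<in>\<D> ` I. id d)"
    using assms(2-5) by simp
  from assms(1)[unfolded pwLc_bound_def, rule_format, OF this] obtain \<W> where W: "\<forall>d\<in>\<D> ` I. \<W> d \<subseteq> id d \<and> |\<W> d| \<le>o \<kappa>"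
    "F \<subseteq> (\<Union>d\<in>\<D> ` I. X closure_of (\<Union>(\<W> d)))"
    by (elim exE conjE)
  show ?thesis
    by (rule exI[of _ "\<lambda>i. \<W> (\<D> i)"]) (use W in auto)
qed

lemma ball_forward: "\<lbrakk>\<forall>x\<in>A. P x; \<And>x. P x \<Longrightarrow> Q x\<rbrakk> \<Longrightarrow> \<forall>x\<in>A. Q x"
  by blast

lemma pwLc_bound_mono: "pwLc_bound X \<kappa> \<Longrightarrow> \<kappa> \<le>o \<mu> \<Longrightarrow> pwLc_bound X \<mu>"
  unfolding pwLc_bound_def
  by (elim all_forward imp_forward ex_forward conj_forward ball_forward)
    (auto intro: ordLeq_transitive)

lemma character_bound_mono: "character_bound X \<kappa> \<Longrightarrow> \<kappa> \<le>o \<mu> \<Longrightarrow> character_bound X \<mu>"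
  unfolding character_bound_def
  by (elim ball_forward ex_forward conj_forward) (auto intro: ordLeq_transitive)

lemma card_of_family_le: "|\<V> :: 'a set set| \<le>o |UNIV :: ('a set + nat) set|"
  by (rule card_of_ordLeqI[of Inl]) auto

lemma pwLc_bound_UNIV: "pwLc_bound (X :: 'a topology) |UNIV :: ('a set + nat) set|"
  unfolding pwLc_bound_def
proof (intro allI impI)
  fix F \<U> and I :: "'a set set set" and \<D> :: "'a set set \<Rightarrow> 'a set set"
  assume A: "closedin X F \<and> (\<forall>U\<in>\<U>. openin X U) \<and> F \<subseteq> \<Union>\<U> \<and> \<U> = (\<Union>i\<in>I. \<D> i)"
  have "\<Union>(\<D> i) \<subseteq> X closure_of (\<Union>(\<D> i))" if "i \<in> I" for i
    using A that by (intro closure_of_subset) (auto dest: openin_subset)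
  then show "\<exists>\<V>. (\<forall>i\<in>I. \<V> i \<subseteq> \<D> i \<and> |\<V> i| \<le>o |UNIV :: ('a set + nat) set| ) \<and>
             F \<subseteq> (\<Union>i\<in>I. X closure_of (\<Union>(\<V> i)))"
    using A by (intro exI[of _ \<D>] conjI ballI subset_refl card_of_family_le) blast
qed

lemma character_bound_UNIV: "character_bound (X :: 'a topology) |UNIV :: ('a set + nat) set|"
  unfolding character_bound_def local_base_at_def
proof
  fix x
  show "\<exists>\<B>. ((\<forall>B\<in>\<B>. openin X B \<and> x \<in> B) \<and>
     (\<forall>U. openin X U \<and> x \<in> U \<longrightarrow> (\<exists>B\<in>\<B>. B \<subseteq> U))) \<and> |\<B>| \<le>o |UNIV :: ('a set + nat) set|"
    by (intro exI[of _ "{U. openin X U \<and> x \<in> U}"] conjI card_of_family_le) auto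
qed

lemma Cinfinite_UNIV_sum: "Cinfinite |UNIV :: ('a set + nat) set|"
  by (simp add: cinfinite_def Field_card_of card_of_card_order_on finite_Plus_UNIV_iff)

lemma least_Cinfinite:
  fixes P :: "'k rel \<Rightarrow> bool" and Q :: "'m rel \<Rightarrow> bool"
  assumes "Cinfinite |UNIV :: 'k set|" "P |UNIV :: 'k set|"
  shows "Cinfinite (least_Cinfinite P)" "P (least_Cinfinite P)"
    and "\<lbrakk>\<And>\<mu> \<nu>. Q \<mu> \<Longrightarrow> \<mu> \<le>o \<nu> \<Longrightarrow> P \<nu>; Cinfinite \<mu>; Q \<mu>\<rbrakk> \<Longrightarrow> least_Cinfinite P \<le>o \<mu>"
proof -
  let ?L = "\<lambda>\<kappa>. Cinfinite \<kappa> \<and> P \<kappa> \<and> (\<forall>\<mu>. Cinfinite \<mu> \<and> P \<mu> \<longrightarrow> \<kappa> \<le>o \<mu>)"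
  have "\<exists>r\<in>{\<kappa>. Cinfinite \<kappa> \<and> P \<kappa>}. \<forall>r'\<in>{\<kappa>. Cinfinite \<kappa> \<and> P \<kappa>}. r \<le>o r'"
    by (rule exists_minim_Card_order) (use assms in auto)
  then have "\<exists>\<kappa>. ?L \<kappa>" by blast
  then have L: "?L (least_Cinfinite P)"
    unfolding least_Cinfinite_def by (rule someI_ex)
  then show "Cinfinite (least_Cinfinite P)" "P (least_Cinfinite P)" by auto
  assume Q: "\<And>\<mu> \<nu>. Q \<mu> \<Longrightarrow> \<mu> \<le>o \<nu> \<Longrightarrow> P \<nu>" and \<mu>: "Cinfinite \<mu>" "Q \<mu>"
  show "least_Cinfinite P \<le>o \<mu>"
  proof (cases "\<mu> \<le>o |UNIV :: 'k set|")
    case True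
    then have "|Field \<mu>| \<le>o |UNIV :: 'k set|"
      using \<mu>(1) card_of_Field_ordIso ordIso_ordLeq_trans by blast
    then obtain f :: "'m \<Rightarrow> 'k" where f: "inj_on f (Field \<mu>)"
      using card_of_ordLeq[of "Field \<mu>" "UNIV :: 'k set"] by auto
    have "|Field \<mu>| =o |f ` Field \<mu>|"
      using card_of_ordIsoI f inj_on_imp_bij_betw by blast
    then have iso: "\<mu> =o |f ` Field \<mu>|"
      using \<mu>(1) card_of_Field_ordIso ordIso_symmetric ordIso_transitive by blast
    have "P |f ` Field \<mu>|"
      using Q[OF \<mu>(2)] iso ordIso_iff_ordLeq by blast
    moreover have "Cinfinite |f ` Field \<mu>|"
      using \<mu>(1) iso Cinfinite_cong by blast
    ultimately have "least_Cinfinite P \<le>o |f ` Field \<mu>|" using L by blast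
    then show ?thesis using iso ordIso_symmetric ordLeq_ordIso_trans by blast
  next
    case False
    then have "|UNIV :: 'k set| \<le>o \<mu>"
      using \<mu>(1) ordLeq_total[of \<mu> "|UNIV :: 'k set|"] card_of_Well_order
        card_order_on_well_order_on by blast
    moreover have "least_Cinfinite P \<le>o |UNIV :: 'k set|" using L assms by blast
    ultimately show ?thesis using ordLeq_transitive by blast
  qed
qed

lemma pwLc_Cinfinite: "Cinfinite (pwLc X)"
  and pwLc_bound_pwLc: "pwLc_bound X (pwLc X)"
  unfolding pwLc_def
  by (rule least_Cinfinite; rule Cinfinite_UNIV_sum pwLc_bound_UNIV)+

lemma pwLc_least:
  fixes \<mu> :: "'m rel"
  assumes "Cinfinite \<mu>" "pwLc_bound X \<mu>"
  shows "pwLc X \<le>o \<mu>"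
  unfolding pwLc_def
  by (rule least_Cinfinite(3)[where Q = "pwLc_bound X"])
    (rule Cinfinite_UNIV_sum pwLc_bound_UNIV assms | erule (1) pwLc_bound_mono)+

lemma character_Cinfinite: "Cinfinite (character X)"
  and character_bound_character: "character_bound X (character X)"
  unfolding character_def
  by (rule least_Cinfinite; rule Cinfinite_UNIV_sum character_bound_UNIV)+

lemma character_least:
  fixes \<mu> :: "'m rel"
  assumes "Cinfinite \<mu>" "character_bound X \<mu>"
  shows "character X \<le>o \<mu>"
  unfolding character_def
  by (rule least_Cinfinite(3)[where Q = "character_bound X"])
    (rule Cinfinite_UNIV_sum character_bound_UNIV assms | erule (1) character_bound_mono)+

end

theory Submission
  imports Defs
begin

text \<open>
  Let \<open>\<kappa> = pwL\<^sub>c(X) \<cdot> \<chi>(X)\<close> and fix local bases \<open>b x \<gamma>\<close>, indexed by \<open>\<gamma> < \<kappa>\<close>, at all points \<open>x\<close>.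
  Closing off in \<open>\<kappa>\<^sup>+\<close> steps gives a set \<open>H\<close> of size at most \<open>2\<^sup>\<kappa>\<close> that contains the closure of
  each of its subsets of size at most \<open>\<kappa>\<close>, hence is closed as the character is at most \<open>\<kappa>\<close>. It also
  contains a point of the complement of \<open>\<Union>\<^sub>\<gamma> cl (\<Union>\<V>\<^sub>\<gamma>)\<close>, if there is one, for all \<open>\<kappa>\<close>-sequences of
  families \<open>\<V>\<^sub>\<gamma>\<close> of at most \<open>\<kappa>\<close> basic neighbourhoods of points of \<open>H\<close>. If some \<open>p\<close> were not in
  \<open>H\<close>, decompose the family of all basic neighbourhoods \<open>b x \<beta>\<close> (\<open>x \<in> H\<close>) disjoint from some basic
  neighbourhood of \<open>p\<close> according to the index \<open>\<gamma>\<close> for which \<open>b x \<beta> \<inter> b p \<gamma> = {}\<close>. The \<open>\<V>\<^sub>\<gamma>\<close>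
  provided by \<open>pwL\<^sub>c\<close> satisfy \<open>H \<subseteq> \<Union>\<^sub>\<gamma> cl (\<Union>\<V>\<^sub>\<gamma>)\<close>, but \<open>b p \<gamma>\<close> keeps \<open>p\<close> outside this union, so \<open>H\<close>
  would also contain a point outside it.
\<close>

section \<open>Cardinal arithmetic at 2^\<kappa>\<close>

lemma Cinfinite_ctwo_cexp: "Cinfinite \<kappa> \<Longrightarrow> Cinfinite (ctwo ^c \<kappa>)"
  by (rule Cinfinite_cexp) (rule ordLeq_refl[OF Card_order_ctwo])

lemma card_of_le_Field: "Card_order \<kappa> \<Longrightarrow> |A| \<le>o \<kappa> \<Longrightarrow> |A| \<le>o |Field \<kappa>|"
  by (meson card_of_Field_ordIso ordIso_symmetric ordLeq_ordIso_trans)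

lemma card_of_Field_le: "Card_order \<kappa> \<Longrightarrow> |Field \<kappa>| \<le>o \<kappa>"
  by (rule ordIso_imp_ordLeq[OF card_of_Field_ordIso])

lemma card_of_Pow_le_ctwo_cexp:
  assumes "Card_order \<kappa>" "|A| \<le>o \<kappa>"
  shows "|Pow A| \<le>o ctwo ^c \<kappa>"
proof -
  obtain f where "inj_on f A" "f ` A \<subseteq> Field \<kappa>"
    using card_of_le_Field[OF assms] card_of_ordLeq[of A "Field \<kappa>", symmetric] by auto
  then have "|Pow A| \<le>o |Pow (Field \<kappa>)|"
    by (intro card_of_ordLeqI[of "image f"] inj_on_image_Pow) auto
  moreover have "|Pow (Field \<kappa>)| =o ctwo ^c \<kappa>"
    unfolding ctwo_def cexp_def Field_card_of by (rule card_of_Pow_Func)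
  ultimately show ?thesis by (rule ordLeq_ordIso_trans)
qed

text \<open>Exponents multiply: (2^\<kappa>)^\<kappa> = 2^(\<kappa> \<cdot> \<kappa>) =
  2^\<kappa>.\<close>

lemma card_of_Func_le_ctwo_cexp:
  assumes "Cinfinite \<kappa>" "|S| \<le>o ctwo ^c \<kappa>"
  shows "|Func (Field \<kappa>) S| \<le>o ctwo ^c \<kappa>"
proof -
  have "|Func (Field \<kappa>) S| = |S| ^c \<kappa>"
    by (simp add: cexp_def Field_card_of)
  moreover have "|S| ^c \<kappa> \<le>o (ctwo ^c \<kappa>) ^c \<kappa>"
    using assms by (intro cexp_mono1) auto
  moreover have "(ctwo ^c \<kappa>) ^c \<kappa> =o ctwo ^c \<kappa>"
    using assms(1) Cinfinite_Cnotzero ordLeq_refl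
    by (intro cexp_cprod_ordLeq Card_order_ctwo) auto
  ultimately show ?thesis using ordLeq_ordIso_trans by metis
qed

lemma card_of_image_le: "|A| \<le>o r \<Longrightarrow> |f ` A| \<le>o r"
  by (rule ordLeq_transitive[OF card_of_image])

lemma card_of_subset_le: "|B| \<le>o r \<Longrightarrow> A \<subseteq> B \<Longrightarrow> |A| \<le>o r"
  by (rule ordLeq_transitive[OF card_of_mono1])

lemma card_of_singleton_le: "Cinfinite r \<Longrightarrow> |{x}| \<le>o r"
  by (rule Card_order_singl_ordLeq) (fastforce simp: cinfinite_def)+

lemma exists_image_Field:
  assumes "Card_order \<kappa>" "|A| \<le>o \<kappa>" "A \<noteq> {}"
  obtains f where "f ` Field \<kappa> = A"
proof -
  have "\<exists>f. f ` Field \<kappa> = A"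
    using card_of_le_Field[OF assms(1,2)] unfolding card_of_ordLeq2[OF assms(3)] .
  then show ?thesis using that by blast
qed

text \<open>A nonempty set of size at most \<kappa> is the range of a \<kappa>-sequence, and
  \<open>S\<close> admits at most 2^\<kappa> such sequences; the empty set is counted apart.\<close>

lemma card_of_small_subsets_le:
  assumes \<kappa>: "Cinfinite \<kappa>" and S: "|S| \<le>o ctwo ^c \<kappa>"
  shows "|{A. A \<subseteq> S \<and> |A| \<le>o \<kappa>}| \<le>o ctwo ^c \<kappa>"
proof -
  have "{A. A \<subseteq> S \<and> |A| \<le>o \<kappa>} \<subseteq> {{}} \<union> (\<lambda>f. f ` Field \<kappa>) ` Func (Field \<kappa>) S"
  proof
    fix A assume A: "A \<in> {A. A \<subseteq> S \<and> |A| \<le>o \<kappa>}"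
    show "A \<in> {{}} \<union> (\<lambda>f. f ` Field \<kappa>) ` Func (Field \<kappa>) S"
    proof (cases "A = {}")
      case False
      then obtain f where f: "f ` Field \<kappa> = A"
        using exists_image_Field \<kappa> A by blast
      let ?g = "\<lambda>i. if i \<in> Field \<kappa> then f i else undefined"
      have "?g \<in> Func (Field \<kappa>) S" "?g ` Field \<kappa> = A"
        using f A by (auto simp: Func_def)
      then show ?thesis by blast
    qed simp
  qed
  moreover have "|{{}} \<union> (\<lambda>f. f ` Field \<kappa>) ` Func (Field \<kappa>) S| \<le>o ctwo ^c \<kappa>"
    using \<kappa> S
    by (intro Un_Cinfinite_bound card_of_singleton_le card_of_image_le
        card_of_Func_le_ctwo_cexp Cinfinite_ctwo_cexp)
  ultimately show ?thesis by (rule card_of_subset_le[rotated])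
qed

section \<open>Closing off in \<kappa>^+ stages\<close>

text \<open>Since \<kappa>^+ is regular, a subset of size at most \<kappa> of the union of the
  increasing stages lies in a single stage, so later stages contain its image under
  \<open>op\<close>. The union stays small because \<kappa>^+ \<le> 2^\<kappa>.\<close>

lemma exists_closed_under_small_sets:
  fixes op :: "'a set \<Rightarrow> 'a set"
  assumes \<kappa>: "Cinfinite \<kappa>"
    and op: "\<And>A. |A| \<le>o \<kappa> \<Longrightarrow> |op A| \<le>o ctwo ^c \<kappa>"
  obtains H where "|H| \<le>o ctwo ^c \<kappa>" "\<And>A. A \<subseteq> H \<Longrightarrow> |A| \<le>o \<kappa> \<Longrightarrow> op A \<subseteq> H"
proof -
  define step where "step S = S \<union> (\<Union>A\<in>{A. A \<subseteq> S \<and> |A| \<le>o \<kappa>}. op A)" for S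
  let ?s = "cardSuc \<kappa>"
  have s: "Cinfinite ?s" using \<kappa> by (rule Cinfinite_cardSuc)
  have wo: "Well_order ?s" using \<kappa> by (intro cardSuc_Well_order) simp
  then have wf: "wf (?s - Id)" by (simp add: well_order_on_def)
  \<comment> \<open>One clause serves zero, successors and limits: a stage collects the steps of all
    earlier ones, and the first stage is empty.\<close>
  define G where "G = wfrec (?s - Id) (\<lambda>g i. \<Union>j\<in>underS ?s i. step (g j))"
  have G: "G i = (\<Union>j\<in>underS ?s i. step (G j))" for i
  proof -
    have "G i = (\<Union>j\<in>underS ?s i. step (cut G (?s - Id) i j))"
      unfolding G_def by (rule wfrec[OF wf])
    also have "\<dots> = (\<Union>j\<in>underS ?s i. step (G j))"
      by (intro SUP_cong refl) (simp add: cut_apply underS_def)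
    finally show ?thesis .
  qed
  have step: "|step S| \<le>o ctwo ^c \<kappa>" if "|S| \<le>o ctwo ^c \<kappa>" for S
    unfolding step_def using that \<kappa> op
    by (intro Un_Cinfinite_bound UNION_Cinfinite_bound card_of_small_subsets_le
        Cinfinite_ctwo_cexp) auto
  have \<kappa>_le: "\<kappa> \<le>o ctwo ^c \<kappa>"
    using \<kappa> ordLess_ctwo_cexp ordLess_imp_ordLeq by blast
  have cardG: "i \<in> Field ?s \<longrightarrow> |G i| \<le>o ctwo ^c \<kappa>" for i
  proof (induction i rule: wf_induct_rule[OF wf])
    case (1 i)
    show ?case
    proof
      assume i: "i \<in> Field ?s"
      have "|underS ?s i| <o ?s" using s i by (intro card_of_underS) auto
      then have "|underS ?s i| \<le>o \<kappa>"
        using cardSuc_ordLeq_ordLess[of \<kappa> "|underS ?s i|"] \<kappa> card_of_Card_order by blast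
      then have U: "|underS ?s i| \<le>o ctwo ^c \<kappa>" using \<kappa>_le ordLeq_transitive by blast
      have "\<forall>j\<in>underS ?s i. |step (G j)| \<le>o ctwo ^c \<kappa>"
        using 1 by (auto intro!: step simp: underS_def Field_def)
      then show "|G i| \<le>o ctwo ^c \<kappa>"
        unfolding G[of i] using U Cinfinite_ctwo_cexp[OF \<kappa>] by (intro UNION_Cinfinite_bound)
    qed
  qed
  have chain: "relChain ?s G"
    unfolding relChain_def
  proof (intro allI impI)
    fix i j assume "(i, j) \<in> ?s"
    then have "underS ?s i \<subseteq> underS ?s j"
      using wo unfolding well_order_on_def linear_order_on_def partial_order_on_def
        preorder_on_def by (auto simp: underS_def dest: transD antisymD)
    then show "G i \<subseteq> G j" unfolding G[of i] G[of j] by blast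
  qed
  define H where "H = (\<Union>i\<in>Field ?s. G i)"
  have "|Field ?s| \<le>o ctwo ^c \<kappa>"
  proof -
    have "?s \<le>o ctwo ^c \<kappa>"
      using cardSuc_ordLess_ordLeq[of \<kappa> "ctwo ^c \<kappa>"] \<kappa> ordLess_ctwo_cexp Card_order_cexp
      by blast
    then show ?thesis using s card_of_Field_ordIso ordIso_ordLeq_trans by blast
  qed
  then have "|H| \<le>o ctwo ^c \<kappa>"
    unfolding H_def using cardG Cinfinite_ctwo_cexp[OF \<kappa>] by (intro UNION_Cinfinite_bound) auto
  moreover have "op A \<subseteq> H" if A: "A \<subseteq> H" "|A| \<le>o \<kappa>" for A
  proof -
    obtain i where i: "i \<in> Field ?s" "A \<subseteq> G i"
      using cardSuc_UNION_Cinfinite[OF \<kappa> chain _ A(2)] A(1) unfolding H_def by blast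
    \<comment> \<open>As \<kappa>^+ has no last element, some stage after \<open>i\<close> absorbs
      \<open>step (G i)\<close>.\<close>
    obtain j where j: "j \<in> Field ?s" "i \<noteq> j" "(i, j) \<in> ?s"
      using infinite_Card_order_limit[of ?s i] s i unfolding cinfinite_def by blast
    have "op A \<subseteq> step (G i)" unfolding step_def using i(2) A(2) by blast
    also have "\<dots> \<subseteq> G j" unfolding G[of j] using j by (auto simp: underS_def)
    finally show ?thesis unfolding H_def using j(1) by blast
  qed
  ultimately show ?thesis by (rule that)
qed

section \<open>Hausdorff spaces with local bases indexed by \<kappa>\<close>

text \<open>All local bases are enumerated, possibly with repetitions, by the same set
  \<open>Field \<kappa>\<close>, so the basic neighbourhoods of one point can later index a
  decomposition.\<close>

locale Hausdorff_with_bases =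
  fixes X :: "'a topology" and \<kappa> :: "'k rel" and b :: "'a \<Rightarrow> 'k \<Rightarrow> 'a set"
  assumes Hausdorff: "Hausdorff_space X"
    and Cinfinite: "Cinfinite \<kappa>"
    and base: "x \<in> topspace X \<Longrightarrow> local_base_at X x (b x ` Field \<kappa>)"
begin

lemma openin_base: "x \<in> topspace X \<Longrightarrow> \<gamma> \<in> Field \<kappa> \<Longrightarrow> openin X (b x \<gamma>)"
  and mem_base: "x \<in> topspace X \<Longrightarrow> \<gamma> \<in> Field \<kappa> \<Longrightarrow> x \<in> b x \<gamma>"
  using base unfolding local_base_at_def by blast+

lemma base_within:
  assumes "x \<in> topspace X" "openin X U" "x \<in> U"
  obtains \<gamma> where "\<gamma> \<in> Field \<kappa>" "b x \<gamma> \<subseteq> U"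
  using base[OF assms(1)] assms(2,3) unfolding local_base_at_def by blast

lemma base_separation:
  assumes "x \<in> topspace X" "y \<in> topspace X" "x \<noteq> y"
  obtains \<beta> \<gamma> where "\<beta> \<in> Field \<kappa>" "\<gamma> \<in> Field \<kappa>" "b x \<beta> \<inter> b y \<gamma> = {}"
proof -
  obtain U V where UV: "openin X U" "openin X V" "x \<in> U" "y \<in> V" "disjnt U V"
    using Hausdorff assms unfolding Hausdorff_space_def by blast
  obtain \<beta> \<gamma> where "\<beta> \<in> Field \<kappa>" "b x \<beta> \<subseteq> U" "\<gamma> \<in> Field \<kappa>" "b y \<gamma> \<subseteq> V"
    using base_within assms UV by metis
  then show ?thesis using that UV(5) unfolding disjnt_def by blast
qed

lemma card_of_closure_le:
  assumes A: "|A| \<le>o \<kappa>"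
  shows "|X closure_of A| \<le>o ctwo ^c \<kappa>"
proof -
  \<comment> \<open>A point of the closure is determined by the traces of its basic neighbourhoods on \<open>A\<close>.\<close>
  let ?tr = "\<lambda>x \<gamma>. if \<gamma> \<in> Field \<kappa> then b x \<gamma> \<inter> A else undefined"
  have "inj_on ?tr (X closure_of A)"
  proof (rule inj_onI, rule ccontr)
    fix x y assume xy: "x \<in> X closure_of A" "y \<in> X closure_of A" "?tr x = ?tr y" "x \<noteq> y"
    then have top: "x \<in> topspace X" "y \<in> topspace X" by (auto simp: in_closure_of)
    obtain \<beta> \<gamma> where bc: "\<beta> \<in> Field \<kappa>" "\<gamma> \<in> Field \<kappa>" "b x \<beta> \<inter> b y \<gamma> = {}"
      using base_separation[OF top xy(4)] .
    \<comment> \<open>A point of \<open>A\<close> in this intersection is carried into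
      \<open>b y \<gamma>\<close> by the equality of traces at \<gamma>, although
      \<open>b x \<beta>\<close> and \<open>b y \<gamma>\<close> are disjoint.\<close>
    have "x \<in> b x \<beta> \<inter> b x \<gamma>" "openin X (b x \<beta> \<inter> b x \<gamma>)"
      using top bc openin_base mem_base by auto
    then obtain a where "a \<in> A" "a \<in> b x \<beta>" "a \<in> b x \<gamma>"
      using xy(1) unfolding in_closure_of by blast
    moreover have "b x \<gamma> \<inter> A = b y \<gamma> \<inter> A" using fun_cong[OF xy(3), of \<gamma>] bc by simp
    ultimately show False using bc(3) by blast
  qed
  then have "|X closure_of A| \<le>o |Func (Field \<kappa>) (Pow A)|"
    by (rule card_of_ordLeqI) (auto simp: Func_def)
  moreover have "|Func (Field \<kappa>) (Pow A)| \<le>o ctwo ^c \<kappa>"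
    using Cinfinite A by (intro card_of_Func_le_ctwo_cexp card_of_Pow_le_ctwo_cexp) auto
  ultimately show ?thesis by (rule ordLeq_transitive)
qed

text \<open>For a point in the closure of \<open>H\<close>, one point of \<open>H\<close> from each
  of its basic neighbourhoods gives at most \<kappa> points whose closure already contains
  it.\<close>

lemma closedin_if_small_closures:
  assumes H: "H \<subseteq> topspace X" and cl: "\<And>A. A \<subseteq> H \<Longrightarrow> |A| \<le>o \<kappa> \<Longrightarrow> X closure_of A \<subseteq> H"
  shows "closedin X H"
proof -
  have "x \<in> H" if x: "x \<in> X closure_of H" for x
  proof -
    have top: "x \<in> topspace X" using x by (simp add: in_closure_of)
    have "\<forall>\<gamma>\<in>Field \<kappa>. \<exists>h. h \<in> H \<and> h \<in> b x \<gamma>"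
      using x openin_base[OF top] mem_base[OF top] unfolding in_closure_of by blast
    then obtain h where h: "\<And>\<gamma>. \<gamma> \<in> Field \<kappa> \<Longrightarrow> h \<gamma> \<in> H \<and> h \<gamma> \<in> b x \<gamma>" by metis
    have "x \<in> X closure_of (h ` Field \<kappa>)"
      unfolding in_closure_of
    proof (intro conjI allI impI top)
      fix U assume "x \<in> U \<and> openin X U"
      then obtain \<gamma> where "\<gamma> \<in> Field \<kappa>" "b x \<gamma> \<subseteq> U" using base_within[OF top] by blast
      then show "\<exists>y. y \<in> h ` Field \<kappa> \<and> y \<in> U" using h by blast
    qed
    moreover have "|h ` Field \<kappa>| \<le>o \<kappa>"
      using Cinfinite by (intro card_of_image_le card_of_Field_le) auto
    moreover have "h ` Field \<kappa> \<subseteq> H" using h by blast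
    ultimately show ?thesis using cl by blast
  qed
  then show ?thesis using closure_of_subset_eq[of H X] H by blast
qed

section \<open>The closing-off operation and the bound on the space\<close>

definition uncovered :: "('k \<Rightarrow> 'a set set) \<Rightarrow> 'a set" where
  "uncovered \<V> = topspace X - (\<Union>\<gamma>\<in>Field \<kappa>. X closure_of (\<Union>(\<V> \<gamma>)))"

text \<open>If |A| \<le> \<kappa>, there are at most \<kappa> basic sets at points of
  \<open>A\<close>, so every family in such a sequence has size at most \<kappa>.
  \<open>Func\<close> fixes the values outside \<open>Field \<kappa>\<close>, which makes the
  sequences countable by 2^\<kappa>.\<close>

definition base_families :: "'a set \<Rightarrow> ('k \<Rightarrow> 'a set set) set" where
  "base_families A = Func (Field \<kappa>) (Pow (case_prod b ` (A \<times> Field \<kappa>)))"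

text \<open>Only one chosen witness is added for each sequence of families, which keeps the size at
  most 2^\<kappa>.\<close>

definition hull_step :: "'a set \<Rightarrow> 'a set" where
  "hull_step A = X closure_of A \<union>
     (\<lambda>\<V>. SOME q. q \<in> uncovered \<V>) ` {\<V> \<in> base_families A. uncovered \<V> \<noteq> {}}"

lemma hull_step_subset_topspace: "hull_step A \<subseteq> topspace X"
proof -
  have "(SOME q. q \<in> uncovered \<V>) \<in> topspace X" if "uncovered \<V> \<noteq> {}" for \<V>
    using some_in_eq[of "uncovered \<V>"] that unfolding uncovered_def by blast
  then show ?thesis unfolding hull_step_def using closure_of_subset_topspace[of X A] by blast
qed

lemma hull_step_meets_uncovered:
  assumes "\<V> \<in> base_families A" "uncovered \<V> \<noteq> {}"
  shows "hull_step A \<inter> uncovered \<V> \<noteq> {}"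
  using assms some_in_eq[of "uncovered \<V>"] unfolding hull_step_def by blast

lemma card_of_hull_step_le:
  assumes "|A| \<le>o \<kappa>"
  shows "|hull_step A| \<le>o ctwo ^c \<kappa>"
proof -
  have "|Field \<kappa>| \<le>o \<kappa>" using Cinfinite card_of_Field_le by blast
  then have "|A \<times> Field \<kappa>| \<le>o \<kappa>"
    using assms Cinfinite by (simp add: card_of_Times_ordLeq_infinite_Field cinfinite_def)
  then have "|base_families A| \<le>o ctwo ^c \<kappa>"
    unfolding base_families_def using Cinfinite
    by (intro card_of_Func_le_ctwo_cexp card_of_Pow_le_ctwo_cexp card_of_image_le) auto
  then have "|{\<V> \<in> base_families A. uncovered \<V> \<noteq> {}}| \<le>o ctwo ^c \<kappa>"
    by (rule card_of_subset_le) blast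
  then show ?thesis
    unfolding hull_step_def using assms Cinfinite
    by (intro Un_Cinfinite_bound card_of_closure_le card_of_image_le Cinfinite_ctwo_cexp)
qed

lemma card_of_topspace_le:
  assumes pwLc: "pwLc_bound X \<kappa>"
  shows "|topspace X| \<le>o ctwo ^c \<kappa>"
proof -
  obtain H' where H': "|H'| \<le>o ctwo ^c \<kappa>"
    "\<And>A. A \<subseteq> H' \<Longrightarrow> |A| \<le>o \<kappa> \<Longrightarrow> hull_step A \<subseteq> H'"
    using exists_closed_under_small_sets[of \<kappa> hull_step, OF Cinfinite card_of_hull_step_le]
    by blast
  \<comment> \<open>The closing-off took place in the whole type; since \<open>hull_step\<close> has
    values inside the space, the points outside it can be cut away.\<close>
  define H where "H = H' \<inter> topspace X"
  have H: "H \<subseteq> topspace X" and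
    hull: "\<And>A. A \<subseteq> H \<Longrightarrow> |A| \<le>o \<kappa> \<Longrightarrow> hull_step A \<subseteq> H"
    unfolding H_def using H'(2) hull_step_subset_topspace by blast+
  have closed: "closedin X H"
    by (rule closedin_if_small_closures[OF H]) (use hull in \<open>auto simp: hull_step_def\<close>)
  have "topspace X \<subseteq> H"
  proof (rule ccontr)
    assume "\<not> topspace X \<subseteq> H"
    then obtain p where p: "p \<in> topspace X" "p \<notin> H" by blast
    define \<D> where "\<D> \<gamma> =
      case_prod b ` {(x, \<beta>). x \<in> H \<and> \<beta> \<in> Field \<kappa> \<and> b x \<beta> \<inter> b p \<gamma> = {}}" for \<gamma>
    have "openin X U" if "U \<in> (\<Union>\<gamma>\<in>Field \<kappa>. \<D> \<gamma>)" for U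
      using that H openin_base unfolding \<D>_def by auto
    moreover have "H \<subseteq> \<Union>(\<Union>\<gamma>\<in>Field \<kappa>. \<D> \<gamma>)"
    proof
      fix x assume x: "x \<in> H"
      then obtain \<beta> \<gamma> where bc: "\<beta> \<in> Field \<kappa>" "\<gamma> \<in> Field \<kappa>" "b x \<beta> \<inter> b p \<gamma> = {}"
        using base_separation[of x p] p H by blast
      then have "b x \<beta> \<in> \<D> \<gamma>" unfolding \<D>_def using x by auto
      moreover have "x \<in> b x \<beta>" using mem_base x H bc(1) by blast
      ultimately show "x \<in> \<Union>(\<Union>\<gamma>\<in>Field \<kappa>. \<D> \<gamma>)" using bc(2) by blast
    qed
    ultimately obtain \<V> where \<V>: "\<forall>\<gamma>\<in>Field \<kappa>. \<V> \<gamma> \<subseteq> \<D> \<gamma> \<and> |\<V> \<gamma>| \<le>o \<kappa>"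
      "H \<subseteq> (\<Union>\<gamma>\<in>Field \<kappa>. X closure_of (\<Union>(\<V> \<gamma>)))"
      using pwLc_bound_any_index[OF pwLc closed,
          where \<U> = "\<Union>\<gamma>\<in>Field \<kappa>. \<D> \<gamma>" and \<D> = \<D> and I = "Field \<kappa>"]
      by blast
    have "|Field \<kappa>| \<le>o \<kappa>" using Cinfinite card_of_Field_le by blast
    then have card_\<V>: "|\<Union>\<gamma>\<in>Field \<kappa>. \<V> \<gamma>| \<le>o \<kappa>"
      using \<V>(1) Cinfinite by (intro UNION_Cinfinite_bound) auto
    have "(\<Union>\<gamma>\<in>Field \<kappa>. \<V> \<gamma>) \<subseteq> case_prod b ` (H \<times> Field \<kappa>)"
      using \<V>(1) unfolding \<D>_def by fast
    \<comment> \<open>One pair of centre and index is kept for each chosen basic set, so that at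
      most \<kappa> centres occur.\<close>
    then obtain P where P: "P \<subseteq> H \<times> Field \<kappa>" "inj_on (case_prod b) P"
      "(\<Union>\<gamma>\<in>Field \<kappa>. \<V> \<gamma>) = case_prod b ` P"
      unfolding subset_image_inj by blast
    have "|P| =o |case_prod b ` P|"
      using P(2) card_of_ordIsoI inj_on_imp_bij_betw by blast
    then have "|P| \<le>o \<kappa>" using card_\<V> P(3) ordIso_ordLeq_trans by metis
    then have A: "fst ` P \<subseteq> H" "|fst ` P| \<le>o \<kappa>"
      using P(1) by (auto intro: card_of_image_le)
    \<comment> \<open>The value \<open>undefined\<close> off \<open>Field \<kappa>\<close> is what
      membership in \<open>Func\<close> demands.\<close>
    define \<W> where "\<W> \<gamma> = (if \<gamma> \<in> Field \<kappa> then \<V> \<gamma> else undefined)" for \<gamma>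
    have "P \<subseteq> fst ` P \<times> Field \<kappa>" using P(1) by force
    then have "(\<Union>\<gamma>\<in>Field \<kappa>. \<V> \<gamma>) \<subseteq> case_prod b ` (fst ` P \<times> Field \<kappa>)"
      unfolding P(3) by (rule image_mono)
    then have W: "\<W> \<in> base_families (fst ` P)"
      unfolding base_families_def Func_def \<W>_def by (simp add: UN_subset_iff)
    have unc: "uncovered \<W> = topspace X - (\<Union>\<gamma>\<in>Field \<kappa>. X closure_of (\<Union>(\<V> \<gamma>)))"
      unfolding uncovered_def \<W>_def by simp
    have "p \<notin> X closure_of (\<Union>(\<V> \<gamma>))" if g: "\<gamma> \<in> Field \<kappa>" for \<gamma>
    proof -
      have "b p \<gamma> \<inter> \<Union>(\<V> \<gamma>) = {}" using \<V>(1) g unfolding \<D>_def by fast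
      then show ?thesis
        using openin_base[OF p(1) g] mem_base[OF p(1) g] unfolding in_closure_of by blast
    qed
    then have "p \<in> uncovered \<W>" unfolding unc using p(1) by blast
    then have "hull_step (fst ` P) \<inter> uncovered \<W> \<noteq> {}"
      using hull_step_meets_uncovered[OF W] by blast
    \<comment> \<open>The uncovered point supplied by \<open>hull_step\<close> lies in
      \<open>H\<close>, which the closures cover.\<close>
    then show False using hull[OF A] \<V>(2) unfolding unc by blast
  qed
  then show ?thesis
    using card_of_subset_le[OF H'(1)] unfolding H_def by blast
qed

end

lemma card_of_topspace_le_ctwo_cexp:
  assumes "Hausdorff_space X" "Cinfinite \<kappa>" "pwLc_bound X \<kappa>" "character_bound X \<kappa>"
  shows "|topspace X| \<le>o ctwo ^c \<kappa>"
proof -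
  have "\<exists>f. local_base_at X x (f ` Field \<kappa>)" if x: "x \<in> topspace X" for x
  proof -
    obtain \<B> where B: "local_base_at X x \<B>" "|\<B>| \<le>o \<kappa>"
      using assms(4) x unfolding character_bound_def by blast
    \<comment> \<open>The whole space is an open neighbourhood of \<open>x\<close>, so it contains a
      member of the base; an enumeration by \<open>Field \<kappa>\<close> requires a nonempty
      set.\<close>
    moreover have "\<B> \<noteq> {}" using B(1) x unfolding local_base_at_def by blast
    ultimately show ?thesis using exists_image_Field assms(2) by metis
  qed
  then obtain b where "\<And>x. x \<in> topspace X \<Longrightarrow> local_base_at X x (b x ` Field \<kappa>)" by metis
  then interpret Hausdorff_with_bases X \<kappa> b
    using assms by unfold_locales
  show ?thesis using assms(3) by (rule card_of_topspace_le)
qed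

theorem theorem6:
  fixes X :: "'a topology"
  assumes "Hausdorff_space X"
  shows "|topspace X| \<le>o ctwo ^c (pwLc X *c character X)"
proof (rule card_of_topspace_le_ctwo_cexp[OF assms])
  note inf = pwLc_Cinfinite[of X] character_Cinfinite[of X]
  show "Cinfinite (pwLc X *c character X)"
    using inf by (intro Cinfinite_cprod2 Cinfinite_Cnotzero) auto
  show "pwLc_bound X (pwLc X *c character X)"
    using pwLc_bound_pwLc
    by (rule pwLc_bound_mono)
      (intro ordLeq_ordIso_trans[OF ordLeq_cprod2 cprod_com] Cinfinite_Cnotzero inf conjunct2[OF inf(1)])
  show "character_bound X (pwLc X *c character X)"
    using character_bound_character
    by (rule character_bound_mono)
      (intro ordLeq_cprod2 Cinfinite_Cnotzero inf conjunct2[OF inf(2)])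
qed

end
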